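(* Assume $v(r)=1-r$ for all $r\in[0,1]$ and let $\eta\in C^2([-1,0];\mathbb R)$ (extended by $0$ outside $[-1,0]$) be non-decreasing on $[-1,0]$ with $\|\eta\|_{L^1(\mathbb R)}=1$ and $\eta(-1)=0$. Fix $T>0$, $M_\Delta,\Delta x>0$ and $K\subset\subset\mathbb R$. Let $$\mathcal U_{\Delta,ad}=\Big\{U_o\in(L^1\cap BV)(\mathbb R;[0,1]):\ \exists(U_{o,j})_{j\in\mathbb Z}\text{ s.t. }U_o=\sum_{j\in\mathbb Z}U_{o,j}\chi_{C_j},\ \mathrm{TV}(U_o)\le M_\Delta,\ \mathrm{supp}(U_o)\subset K\Big\}$$ be equipped with the metric induced by the $L^1$ norm. Let $\mathcal J:L^1_{loc}(\mathbb R;\mathbb R)\to\mathbb R_{\ge0}$ and $\mathcal K:L^1_{loc}([0,T]\times\mathbb R;\mathbb R)\to\mathbb R_{\ge0}$ be continuous and $\mathcal I:L^1_{loc}(\mathbb R;\mathbb R)\to\mathbb R_{\ge0}$ be lower semi-continuous with respect to the $L^1_{loc}$ topologies. For $H>0$ define $\mathcal G_{\Delta,H},\mathcal G_\Delta:\mathcal U_{\Delta,ad}\to\mathbb R$ by $$\mathcal G_{\Delta,H}(U_o)=\mathcal J(U_H(T,\cdot))+\mathcal K(U_H)+\mathcal I(U_o),\qquad \mathcal G_\Delta(U_o)=\mathcal J(U(T,\cdot))+\mathcal K(U)+\mathcal I(U_o),$$ where $U_H$ and $U$ are the approximate solutions produced from the initial datum $U_o$ by the nonlocal (with kernel $\eta_H$)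 and the local Eulerian–Lagrangian scheme, respectively. Then the family $\{\mathcal G_{\Delta,H}\}_H$ $\Gamma$-converges to $\mathcal G_\Delta$ in the limit $H\to0^+$.
   Context: Grid: $x_j=j\Delta x$, $x_{j+1/2}=(j+\frac12)\Delta x$, $C_j=[x_{j-1/2},x_{j+1/2}]$, $j\in\mathbb Z$; $t^m=m\Delta t$, $m\in\mathbb N$, where the time step $\Delta t>0$ is fixed (independent of $H$ and of the datum) so that the CFL condition $|V_j^m|\le\frac18\frac{\Delta x}{\Delta t}$ holds for all velocities below (e.g. $\Delta t=\frac18\|v\|_{L^\infty([0,1])}^{-1}\Delta x$). $\chi_A$ is the indicator function. Local Eulerian–Lagrangian scheme: given $U_o=\sum_jU_{o,j}\chi_{C_j}$, set $U_j^0=U_{o,j}$ and $$U_j^{m+1}=\frac{U_{j-1}^m+2U_j^m+U_{j+1}^m}{4}+\frac{\Delta t}{4}\big[\mathcal F_j^m-\mathcal F_{j+1}^m\big],\qquad \mathcal F_j^m=\frac{1}{h_{j-1}^{m+1}}(U_j^m+U_{j-1}^m)(V_j^m+V_{j-1}^m),$$ with $V_j^m=v(U_j^m)$ and $h_j^{m+1}=\Delta x+\Delta t(V_{j+1}^m-V_j^m)$. The approximate solution is $U(t,x)=\sum_{j,m}U_j^m\chi_{C_j}(x)\chi_{[t^m,t^{m+1}]}(t)$, with the convention $U(t^m,\cdot)=\sum_jU_j^m\chi_{C_j}$ (overlaps of the cells $C_j$ are negligible null sets). Nonlocal Eulerian–Lagrangian scheme with parameter $H>0$: the same formulas with $(U_H)_j^m$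 in place of $U_j^m$, except that $(V_H)_j^m=v\big(((U_H)^m*_\Delta\eta_H)_j\big)$ (and correspondingly $(h_H)_j^{m+1}$, $(\mathcal F_H)_j^m$ use $V_H$). Here $\eta_H(x)=\frac1H\eta(\frac xH)$, $N_H=\lceil H/\Delta x\rceil$, and for $f=\sum_jf_j\chi_{C_j}$ $$(f*_\Delta\eta_H)_j=\frac{\sum_{k}f_{j-k}\,\eta_H(x_k)}{\sum_{k}\eta_H(x_k)},\qquad k\text{ ranging over }0,-1,\dots,-N_H+1.$$ $\Gamma$-convergence of $\mathcal G_{\Delta,H}$ to $\mathcal G_\Delta$ on the metric space $\mathcal U_{\Delta,ad}$ as $H\to0^+$ means: for every sequence $H_n\to0^+$, (i) for every $U_o\in\mathcal U_{\Delta,ad}$ and every sequence $U_o^n\to U_o$ in $\mathcal U_{\Delta,ad}$ (in $L^1$), $\mathcal G_\Delta(U_o)\le\liminf_n\mathcal G_{\Delta,H_n}(U_o^n)$; (ii) for every $U_o\in\mathcal U_{\Delta,ad}$ there is a sequence $U_o^n\to U_o$ in $\mathcal U_{\Delta,ad}$ with $\mathcal G_\Delta(U_o)=\lim_n\mathcal G_{\Delta,H_n}(U_o^n)$. *)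

theory Defs
  imports "HOL-Analysis.Analysis"
begin

text \<open>
  Elements of Lebesgue spaces are represented by functions, and two functions that agree almost
  everywhere stand for the same element.  The conditions imposed on such functions are invariant under
  changes on null sets.
\<close>

section \<open>The space of locally integrable functions\<close>

definition L1loc :: "'a::euclidean_space set \<Rightarrow> ('a \<Rightarrow> real) set" where
  "L1loc S = {f. \<forall>C. compact C \<and> C \<subseteq> S \<longrightarrow> f absolutely_integrable_on C}"

text \<open>The topology of the seminorms \<open>f \<mapsto> \<integral>\<^sub>C \<bar>f\<bar>\<close>, with \<open>C \<subseteq> S\<close> compact.  Its open sets are unions of
  almost-everywhere classes, so that a functional that is continuous or lower semicontinuous for it
  descends to these classes.\<close>

definition L1loc_open :: "'a::euclidean_space set \<Rightarrow> ('a \<Rightarrow> real) set \<Rightarrow> bool" where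
  "L1loc_open S A \<longleftrightarrow> A \<subseteq> L1loc S \<and>
     (\<forall>f\<in>A. \<exists>C e. compact C \<and> C \<subseteq> S \<and> e > 0 \<and>
        {g \<in> L1loc S. (LINT x:C|lebesgue. \<bar>g x - f x\<bar>) < e} \<subseteq> A)"

definition L1loc_topology :: "'a::euclidean_space set \<Rightarrow> ('a \<Rightarrow> real) topology" where
  "L1loc_topology S = topology (L1loc_open S)"

lemma L1loc_seminorm_mono:
  assumes "f \<in> L1loc S" "g \<in> L1loc S" "compact D" "D \<subseteq> S" "compact C" "C \<subseteq> D"
  shows "(LINT x:C|lebesgue. \<bar>g x - f x\<bar>) \<le> (LINT x:D|lebesgue. \<bar>g x - f x\<bar>)"
proof -
  have "(\<lambda>x. g x - f x) absolutely_integrable_on D"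
    using assms by (auto simp: L1loc_def intro!: set_integral_diff)
  then have "set_integrable lebesgue D (\<lambda>x. \<bar>g x - f x\<bar>)"
    by (rule set_integrable_abs)
  moreover from this have "set_integrable lebesgue C (\<lambda>x. \<bar>g x - f x\<bar>)"
    by (rule set_integrable_subset) (use assms(5,6) in \<open>auto intro: lmeasurable_compact fmeasurableD\<close>)
  ultimately show ?thesis
    using assms(6) unfolding set_lebesgue_integral_def set_integrable_def
    by (intro integral_mono) (auto simp: indicator_def)
qed

lemma istopology_L1loc_open: "istopology (L1loc_open S)"
  unfolding istopology_def
proof (intro conjI allI impI)
  fix A B assume A: "L1loc_open S A" and B: "L1loc_open S B"
  show "L1loc_open S (A \<inter> B)"
    unfolding L1loc_open_def
  proof (intro conjI ballI)
    show "A \<inter> B \<subseteq> L1loc S" using A by (auto simp: L1loc_open_def)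
    fix f assume f: "f \<in> A \<inter> B"
    then have fS: "f \<in> L1loc S" using A by (auto simp: L1loc_open_def)
    obtain C d where C: "compact C" "C \<subseteq> S" "d > 0"
      "{g \<in> L1loc S. (LINT x:C|lebesgue. \<bar>g x - f x\<bar>) < d} \<subseteq> A"
      using A f unfolding L1loc_open_def by blast
    obtain D e where D: "compact D" "D \<subseteq> S" "e > 0"
      "{g \<in> L1loc S. (LINT x:D|lebesgue. \<bar>g x - f x\<bar>) < e} \<subseteq> B"
      using B f unfolding L1loc_open_def by blast
    have CD: "compact (C \<union> D)" "C \<union> D \<subseteq> S" using C D by auto
    have "{g \<in> L1loc S. (LINT x:C \<union> D|lebesgue. \<bar>g x - f x\<bar>) < min d e} \<subseteq> A \<inter> B"
    proof
      fix g assume g: "g \<in> {g \<in> L1loc S. (LINT x:C \<union> D|lebesgue. \<bar>g x - f x\<bar>) < min d e}"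
      have "(LINT x:C|lebesgue. \<bar>g x - f x\<bar>) \<le> (LINT x:C \<union> D|lebesgue. \<bar>g x - f x\<bar>)"
        using L1loc_seminorm_mono[OF fS _ CD C(1)] g by auto
      moreover have "(LINT x:D|lebesgue. \<bar>g x - f x\<bar>) \<le> (LINT x:C \<union> D|lebesgue. \<bar>g x - f x\<bar>)"
        using L1loc_seminorm_mono[OF fS _ CD D(1)] g by auto
      ultimately show "g \<in> A \<inter> B" using g C(4) D(4) by fastforce
    qed
    then show "\<exists>E r. compact E \<and> E \<subseteq> S \<and> r > 0 \<and>
        {g \<in> L1loc S. (LINT x:E|lebesgue. \<bar>g x - f x\<bar>) < r} \<subseteq> A \<inter> B"
      using CD C(3) D(3) by (intro exI[of _ "C \<union> D"] exI[of _ "min d e"]) auto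
  qed
next
  fix \<A> assume "\<forall>A\<in>\<A>. L1loc_open S A"
  then show "L1loc_open S (\<Union>\<A>)"
    unfolding L1loc_open_def by (intro conjI ballI) (blast, meson Union_iff Union_upper order_trans)
qed

lemma openin_L1loc_topology: "openin (L1loc_topology S) A \<longleftrightarrow> L1loc_open S A"
  by (simp add: L1loc_topology_def istopology_L1loc_open topology_inverse')

lemma topspace_L1loc_topology [simp]: "topspace (L1loc_topology S) = L1loc S"
proof -
  have "L1loc_open S (L1loc S)"
    unfolding L1loc_open_def by (auto intro!: exI[of _ "{}"] exI[of _ 1])
  then show ?thesis
    unfolding topspace_def openin_L1loc_topology by (auto simp: L1loc_open_def)
qed

definition lower_semicontinuous_map :: "'a topology \<Rightarrow> ('a \<Rightarrow> real) \<Rightarrow> bool" where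
  "lower_semicontinuous_map X f \<longleftrightarrow> (\<forall>a. openin X {x \<in> topspace X. a < f x})"


section \<open>Gamma-convergence\<close>

text \<open>\<open>F H\<close> is the family indexed by \<open>H > 0\<close>, \<open>X\<close> the carrier and \<open>d\<close> the (pseudo)metric.\<close>

definition gamma_converges ::
  "'a set \<Rightarrow> ('a \<Rightarrow> 'a \<Rightarrow> real) \<Rightarrow> (real \<Rightarrow> 'a \<Rightarrow> real) \<Rightarrow> ('a \<Rightarrow> real) \<Rightarrow> bool" where
  "gamma_converges X d F F0 \<longleftrightarrow>
     (\<forall>H::nat \<Rightarrow> real. (\<forall>n. H n > 0) \<and> H \<longlonglongrightarrow> 0 \<longrightarrow>
        (\<forall>u\<in>X. \<forall>w. (\<forall>n. w n \<in> X) \<and> (\<lambda>n. d (w n) u) \<longlonglongrightarrow> 0 \<longrightarrow>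
           ereal (F0 u) \<le> liminf (\<lambda>n. ereal (F (H n) (w n)))) \<and>
        (\<forall>u\<in>X. \<exists>w. (\<forall>n. w n \<in> X) \<and> (\<lambda>n. d (w n) u) \<longlonglongrightarrow> 0 \<and>
           (\<lambda>n. F (H n) (w n)) \<longlonglongrightarrow> F0 u))"

definition L1_dist :: "(real \<Rightarrow> real) \<Rightarrow> (real \<Rightarrow> real) \<Rightarrow> real" where
  "L1_dist f g = (LINT x|lebesgue. \<bar>f x - g x\<bar>)"


section \<open>Functions of bounded variation and essential support\<close>

text \<open>The total mass of the distributional derivative of \<open>u\<close>.\<close>

definition total_variation :: "(real \<Rightarrow> real) \<Rightarrow> ereal" where
  "total_variation u =
     (SUP \<phi> \<in> {\<phi>. \<phi> C1_differentiable_on UNIV \<and> compact (closure {x. \<phi> x \<noteq> 0}) \<and> (\<forall>x. \<bar>\<phi> x\<bar> \<le> 1)}.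
        ereal (LINT x|lebesgue. u x * deriv \<phi> x))"

definition ess_support :: "(real \<Rightarrow> real) \<Rightarrow> real set" where
  "ess_support u = - \<Union>{A. open A \<and> (AE x in lebesgue. x \<in> A \<longrightarrow> u x = 0)}"


section \<open>Piecewise constant data\<close>

definition cell :: "real \<Rightarrow> int \<Rightarrow> real set" where
  "cell dx j = {(of_int j - 1/2) * dx .. (of_int j + 1/2) * dx}"

definition grid_fun :: "real \<Rightarrow> (int \<Rightarrow> real) \<Rightarrow> real \<Rightarrow> real" where
  "grid_fun dx a x = (\<Sum>\<^sub>\<infinity>j. a j * indicator (cell dx j) x)"

definition admissible_data :: "real \<Rightarrow> real \<Rightarrow> real set \<Rightarrow> (real \<Rightarrow> real) set" where
  "admissible_data dx M K = {u.
     integrable lebesgue u \<and> (AE x in lebesgue. u x \<in> {0..1}) \<and> total_variation u < \<infinity> \<and>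
     (\<exists>a. AE x in lebesgue. u x = grid_fun dx a x) \<and>
     total_variation u \<le> ereal M \<and> ess_support u \<subseteq> K}"

text \<open>The coefficients \<open>U\<^sub>o\<^sub>,\<^sub>j\<close> of \<open>U\<^sub>o\<close>; they are unique, since the cells have disjoint interiors and
  positive length.\<close>

definition cell_values :: "real \<Rightarrow> (real \<Rightarrow> real) \<Rightarrow> int \<Rightarrow> real" where
  "cell_values dx u = (THE a. AE x in lebesgue. u x = grid_fun dx a x)"


section \<open>The Eulerian--Lagrangian schemes\<close>

definition EL_height :: "real \<Rightarrow> real \<Rightarrow> (int \<Rightarrow> real) \<Rightarrow> int \<Rightarrow> real" where
  "EL_height dx dt V j = dx + dt * (V (j + 1) - V j)"

definition EL_flux :: "real \<Rightarrow> real \<Rightarrow> (int \<Rightarrow> real) \<Rightarrow> (int \<Rightarrow> real) \<Rightarrow> int \<Rightarrow> real" where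
  "EL_flux dx dt V U j =
     1 / EL_height dx dt V (j - 1) * (U j + U (j - 1)) * (V j + V (j - 1))"

definition EL_step :: "real \<Rightarrow> real \<Rightarrow> (int \<Rightarrow> real) \<Rightarrow> (int \<Rightarrow> real) \<Rightarrow> int \<Rightarrow> real" where
  "EL_step dx dt V U j =
     (U (j - 1) + 2 * U j + U (j + 1)) / 4
       + dt / 4 * (EL_flux dx dt V U j - EL_flux dx dt V U (j + 1))"

text \<open>\<open>vel\<close> maps the densities at one time level to the velocities at the same level; the two schemes
  differ only in this map.\<close>

primrec EL_scheme ::
  "real \<Rightarrow> real \<Rightarrow> ((int \<Rightarrow> real) \<Rightarrow> int \<Rightarrow> real) \<Rightarrow> (int \<Rightarrow> real) \<Rightarrow> nat \<Rightarrow> int \<Rightarrow> real" where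
  "EL_scheme dx dt vel a 0 = a"
| "EL_scheme dx dt vel a (Suc m) =
     EL_step dx dt (vel (EL_scheme dx dt vel a m)) (EL_scheme dx dt vel a m)"

definition local_velocity :: "(real \<Rightarrow> real) \<Rightarrow> (int \<Rightarrow> real) \<Rightarrow> int \<Rightarrow> real" where
  "local_velocity v U j = v (U j)"

definition scaled_kernel :: "(real \<Rightarrow> real) \<Rightarrow> real \<Rightarrow> real \<Rightarrow> real" where
  "scaled_kernel \<eta> H x = 1 / H * \<eta> (x / H)"

definition discrete_convolution ::
  "real \<Rightarrow> (real \<Rightarrow> real) \<Rightarrow> real \<Rightarrow> (int \<Rightarrow> real) \<Rightarrow> int \<Rightarrow> real" where
  "discrete_convolution dx \<eta> H f j =
     (\<Sum>k\<in>{- \<lceil>H / dx\<rceil> + 1..0}. f (j - k) * scaled_kernel \<eta> H (of_int k * dx))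
       / (\<Sum>k\<in>{- \<lceil>H / dx\<rceil> + 1..0}. scaled_kernel \<eta> H (of_int k * dx))"

definition nonlocal_velocity ::
  "real \<Rightarrow> (real \<Rightarrow> real) \<Rightarrow> (real \<Rightarrow> real) \<Rightarrow> real \<Rightarrow> (int \<Rightarrow> real) \<Rightarrow> int \<Rightarrow> real" where
  "nonlocal_velocity dx v \<eta> H U j = v (discrete_convolution dx \<eta> H U j)"

text \<open>Half-open time slabs implement the convention \<open>U(t\<^sup>m, \<cdot>) = \<Sum>\<^sub>j U\<^sub>j\<^sup>m \<chi>(C\<^sub>j)\<close>; the values on the
  common end points of neighbouring cells lie on a null set.\<close>

definition approx_solution ::
  "real \<Rightarrow> real \<Rightarrow> ((int \<Rightarrow> real) \<Rightarrow> int \<Rightarrow> real) \<Rightarrow> (real \<Rightarrow> real) \<Rightarrow> real \<times> real \<Rightarrow> real" where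
  "approx_solution dx dt vel u = (\<lambda>(t, x).
     \<Sum>\<^sub>\<infinity>(j, m). EL_scheme dx dt vel (cell_values dx u) m j
        * indicator (cell dx j) x * indicator {real m * dt..<(real m + 1) * dt} t)"


section \<open>The functionals\<close>

definition cost ::
  "((real \<Rightarrow> real) \<Rightarrow> real) \<Rightarrow> ((real \<times> real \<Rightarrow> real) \<Rightarrow> real) \<Rightarrow> ((real \<Rightarrow> real) \<Rightarrow> real) \<Rightarrow> real
     \<Rightarrow> ((real \<Rightarrow> real) \<Rightarrow> real \<times> real \<Rightarrow> real) \<Rightarrow> (real \<Rightarrow> real) \<Rightarrow> real" where
  "cost \<J> \<K> \<I> T solve u = \<J> (\<lambda>x. solve u (T, x)) + \<K> (solve u) + \<I> u"

text \<open>Twice continuously differentiable on a closed interval, with one-sided derivatives at its end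
  points (for the nondegenerate interval \<open>S\<close> these are unique).\<close>

definition C2_on :: "real set \<Rightarrow> (real \<Rightarrow> real) \<Rightarrow> bool" where
  "C2_on S f \<longleftrightarrow> (\<exists>f' f''. (\<forall>x\<in>S. (f has_real_derivative f' x) (at x within S)) \<and>
     (\<forall>x\<in>S. (f' has_real_derivative f'' x) (at x within S)) \<and> continuous_on S f'')"

end

theory Submission
  imports Defs
begin

text \<open>Only the grid cell at the evaluation point enters the discrete convolution once \<open>H \<le> dx\<close>, so from
  then on the nonlocal scheme coincides with the local one.  It therefore suffices that the limit cost is
  sequentially lower semicontinuous.  Data converging in \<open>L\<^sup>1\<close> have converging cell values; the local
  scheme preserves the interval \<open>[0,1]\<close>, on which a step is continuous in finitely many cell values; and
  on a compact set only finitely many cells and time slabs matter.\<close>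

section \<open>Convergence of locally integrable functions\<close>

text \<open>Around each of its points an open set contains a ball of a single seminorm, so
  convergence in every seminorm forces the sequence into the set eventually. The two transfer lemmas
  below, for continuous and for lower semicontinuous functionals, rest on this.\<close>

lemma L1loc_open_eventually:
  assumes "L1loc_open S A" "f \<in> A" "\<And>n. g n \<in> L1loc S"
    and "\<And>C. compact C \<Longrightarrow> C \<subseteq> S \<Longrightarrow> (\<lambda>n. LINT x:C|lebesgue. \<bar>g n x - f x\<bar>) \<longlonglongrightarrow> 0"
  shows "\<forall>\<^sub>F n in sequentially. g n \<in> A"
proof -
  obtain C e where C: "compact C" "C \<subseteq> S" "e > 0"
    "{h \<in> L1loc S. (LINT x:C|lebesgue. \<bar>h x - f x\<bar>) < e} \<subseteq> A"
    using assms(1,2) unfolding L1loc_open_def by blast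
  have "\<forall>\<^sub>F n in sequentially. (LINT x:C|lebesgue. \<bar>g n x - f x\<bar>) < e"
    using order_tendstoD(2)[OF assms(4)[OF C(1,2)] C(3)] .
  then show ?thesis
    by eventually_elim (use C(4) assms(3) in blast)
qed

lemma L1loc_continuous_map_tendsto:
  assumes "continuous_map (L1loc_topology S) euclideanreal F"
    and "f \<in> L1loc S" "\<And>n. g n \<in> L1loc S"
    and "\<And>C. compact C \<Longrightarrow> C \<subseteq> S \<Longrightarrow> (\<lambda>n. LINT x:C|lebesgue. \<bar>g n x - f x\<bar>) \<longlonglongrightarrow> 0"
  shows "(\<lambda>n. F (g n)) \<longlonglongrightarrow> F f"
proof (rule topological_tendstoI)
  fix B :: "real set" assume "open B" "F f \<in> B"
  then have "L1loc_open S {x \<in> L1loc S. F x \<in> B}"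
    using assms(1) unfolding continuous_map_def by (simp add: openin_L1loc_topology)
  from L1loc_open_eventually[OF this _ assms(3,4)] show "\<forall>\<^sub>F n in sequentially. F (g n) \<in> B"
    using assms(2) \<open>F f \<in> B\<close> by (auto elim: eventually_mono)
qed

lemma L1loc_lower_semicontinuous_eventually:
  assumes "lower_semicontinuous_map (L1loc_topology S) F"
    and "f \<in> L1loc S" "\<And>n. g n \<in> L1loc S"
    and "\<And>C. compact C \<Longrightarrow> C \<subseteq> S \<Longrightarrow> (\<lambda>n. LINT x:C|lebesgue. \<bar>g n x - f x\<bar>) \<longlonglongrightarrow> 0"
    and "a < F f"
  shows "\<forall>\<^sub>F n in sequentially. a < F (g n)"
proof -
  have "L1loc_open S {x \<in> L1loc S. a < F x}"
    using assms(1) unfolding lower_semicontinuous_map_def by (simp add: openin_L1loc_topology)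
  from L1loc_open_eventually[OF this _ assms(3,4)] show ?thesis
    using assms(2,5) by (auto elim: eventually_mono)
qed

lemma integrable_imp_L1loc:
  fixes f :: "'a::euclidean_space \<Rightarrow> real"
  assumes "integrable lebesgue f" shows "f \<in> L1loc S"
  unfolding L1loc_def set_integrable_def
  by (blast intro: integrable_mult_indicator[OF _ assms] fmeasurableD lmeasurable_compact)

lemma L1_dist_bounds_seminorm:
  assumes "integrable lebesgue f" "integrable lebesgue g" "compact C"
  shows "(LINT x:C|lebesgue. \<bar>f x - g x\<bar>) \<le> L1_dist f g"
  unfolding set_lebesgue_integral_def L1_dist_def
  using assms by (intro integral_mono integrable_mult_indicator)
    (auto simp: indicator_def dest!: lmeasurable_compact fmeasurableD)

section \<open>Step functions with a fixed family of cells and varying coefficients\<close>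

lemma finite_step_function_integrable:
  fixes f :: "'a::euclidean_space \<Rightarrow> real"
  assumes "compact C" "\<And>p. p \<in> P \<Longrightarrow> A p \<in> lmeasurable"
    and "\<And>x. x \<in> C \<Longrightarrow> f x = (\<Sum>p\<in>P. c p * indicator (A p) x)"
  shows "f absolutely_integrable_on C"
proof -
  have "integrable lebesgue (\<lambda>x. \<Sum>p\<in>P. c p * indicator (A p) x)"
    using assms(2)
    by (intro Bochner_Integration.integrable_sum integrable_mult_right) (simp add: lmeasurable_iff_integrable)
  then have "(\<lambda>x. \<Sum>p\<in>P. c p * indicator (A p) x) absolutely_integrable_on C"
    unfolding set_integrable_def
    by (rule integrable_mult_indicator[OF fmeasurableD[OF lmeasurable_compact[OF assms(1)]]])
  then show ?thesis
    using assms(3) by (simp cong: set_integrable_cong)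
qed

text \<open>The integral is at most the sum of \<open>\<bar>c n p - d p\<bar>\<close> times the
  measure of \<open>A p\<close>, a finite sum of null sequences; the sets \<open>A p\<close> may
  overlap. The representations are asked for on \<open>C\<close> only, since approximate solutions
  are finite sums only on bounded sets. For infinite \<open>P\<close> all sums are 0 by convention,
  and then \<open>f n\<close> and \<open>g\<close> vanish on \<open>C\<close>.\<close>

lemma finite_step_function_seminorm_tendsto:
  fixes f :: "nat \<Rightarrow> 'a::euclidean_space \<Rightarrow> real"
  assumes "compact C" "\<And>p. p \<in> P \<Longrightarrow> A p \<in> lmeasurable"
    and f: "\<And>n x. x \<in> C \<Longrightarrow> f n x = (\<Sum>p\<in>P. c n p * indicator (A p) x)"
    and g: "\<And>x. x \<in> C \<Longrightarrow> g x = (\<Sum>p\<in>P. d p * indicator (A p) x)"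
    and c: "\<And>p. p \<in> P \<Longrightarrow> (\<lambda>n. c n p) \<longlonglongrightarrow> d p"
  shows "(\<lambda>n. LINT x:C|lebesgue. \<bar>f n x - g x\<bar>) \<longlonglongrightarrow> 0"
proof (rule tendsto_sandwich)
  let ?b = "\<lambda>n x. \<Sum>p\<in>P. \<bar>c n p - d p\<bar> * indicator (A p) x"
  have ind: "integrable lebesgue (indicator (A p) :: 'a \<Rightarrow> real)" if "p \<in> P" for p
    using assms(2)[OF that] by (simp add: lmeasurable_iff_integrable)
  have b: "integrable lebesgue (?b n)" for n
    using ind by (intro Bochner_Integration.integrable_sum integrable_mult_right)
  have "(LINT x:C|lebesgue. \<bar>f n x - g x\<bar>) \<le> (\<Sum>p\<in>P. \<bar>c n p - d p\<bar> * measure lebesgue (A p))" for n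
  proof -
    have "(LINT x:C|lebesgue. \<bar>f n x - g x\<bar>) \<le> (LINT x|lebesgue. ?b n x)"
      unfolding set_lebesgue_integral_def
    proof (rule integral_mono)
      have "(\<lambda>x. f n x - g x) absolutely_integrable_on C"
        by (intro set_integral_diff finite_step_function_integrable[OF assms(1,2) f]
          finite_step_function_integrable[OF assms(1,2) g])
      from set_integrable_abs[OF this]
      show "integrable lebesgue (\<lambda>x. indicat_real C x *\<^sub>R \<bar>f n x - g x\<bar>)"
        unfolding set_integrable_def .
      fix x
      show "indicat_real C x *\<^sub>R \<bar>f n x - g x\<bar> \<le> ?b n x"
      proof (cases "x \<in> C")
        case True
        have "f n x - g x = (\<Sum>p\<in>P. (c n p - d p) * indicator (A p) x)"
          using f[OF True] g[OF True] by (simp add: sum_subtractf left_diff_distrib)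
        also have "\<bar>\<dots>\<bar> \<le> ?b n x"
          by (rule order_trans[OF sum_abs]) (simp add: abs_mult)
        finally show ?thesis using True by simp
      qed (auto intro!: sum_nonneg)
    qed (rule b)
    also have "\<dots> = (\<Sum>p\<in>P. LINT x|lebesgue. \<bar>c n p - d p\<bar> * indicator (A p) x)"
      using ind by (intro Bochner_Integration.integral_sum) auto
    also have "\<dots> = (\<Sum>p\<in>P. \<bar>c n p - d p\<bar> * measure lebesgue (A p))"
      by simp
    finally show ?thesis .
  qed
  then show "\<forall>\<^sub>F n in sequentially. (LINT x:C|lebesgue. \<bar>f n x - g x\<bar>)
      \<le> (\<Sum>p\<in>P. \<bar>c n p - d p\<bar> * measure lebesgue (A p))" by simp
  show "\<forall>\<^sub>F n in sequentially. 0 \<le> (LINT x:C|lebesgue. \<bar>f n x - g x\<bar>)"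
    by (auto simp: set_lebesgue_integral_def intro!: always_eventually integral_nonneg)
  have "(\<lambda>n. \<Sum>p\<in>P. \<bar>c n p - d p\<bar> * measure lebesgue (A p))
      \<longlonglongrightarrow> (\<Sum>p\<in>P. \<bar>d p - d p\<bar> * measure lebesgue (A p))"
    using c by (intro tendsto_intros) auto
  then show "(\<lambda>n. \<Sum>p\<in>P. \<bar>c n p - d p\<bar> * measure lebesgue (A p)) \<longlonglongrightarrow> 0" by simp
qed simp

section \<open>Cell values\<close>

text \<open>A nonempty open set is not negligible, so it cannot lie inside the exceptional null set.
  Applied to the interior of a cell, this turns statements almost everywhere into statements about
  coefficients.\<close>

lemma AE_lebesgue_ex_in_open:
  fixes S :: "'a::euclidean_space set"
  assumes "AE x in lebesgue. P x" "open S" "S \<noteq> {}"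
  shows "\<exists>x\<in>S. P x"
proof (rule ccontr)
  assume "\<not> (\<exists>x\<in>S. P x)"
  moreover obtain N where "{x. \<not> P x} \<subseteq> N" "N \<in> null_sets lebesgue"
    using assms(1) by (auto elim: AE_E3 simp: eventually_ae_filter)
  ultimately have "negligible S"
    by (metis (mono_tags, lifting) mem_Collect_eq negligible_iff_null_sets negligible_subset subset_iff)
  then show False using open_not_negligible assms(2,3) by blast
qed

text \<open>Closed cells share end points, where \<open>grid_fun\<close> adds two coefficients. On
  the interior of a cell exactly one term of the sum survives, so coefficients are read off
  there.\<close>

definition open_cell :: "real \<Rightarrow> int \<Rightarrow> real set" where
  "open_cell dx j = {(of_int j - 1/2) * dx <..< (of_int j + 1/2) * dx}"

lemma open_cell_nonempty: "dx > 0 \<Longrightarrow> open_cell dx j \<noteq> {}"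
  by (simp add: open_cell_def)

lemma open_cell_in_cell_iff:
  assumes "dx > 0" "x \<in> open_cell dx j"
  shows "x \<in> cell dx i \<longleftrightarrow> i = j"
proof
  assume "x \<in> cell dx i"
  then have "(of_int i - 1/2) * dx < (of_int j + 1/2) * dx"
    "(of_int j - 1/2) * dx < (of_int i + 1/2) * dx"
    using assms(2) by (auto simp: cell_def open_cell_def)
  then have "real_of_int i < of_int j + 1" "real_of_int j < of_int i + 1"
    using assms(1) by auto
  then show "i = j" by linarith
qed (use assms in \<open>auto simp: cell_def open_cell_def\<close>)

lemma grid_fun_open_cell:
  assumes "dx > 0" "x \<in> open_cell dx j"
  shows "grid_fun dx a x = a j"
proof -
  have "grid_fun dx a x = (\<Sum>\<^sub>\<infinity>i\<in>{j}. a i * indicator (cell dx i) x)"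
    unfolding grid_fun_def
    by (rule infsum_cong_neutral) (auto simp: open_cell_in_cell_iff[OF assms] indicator_def)
  then show ?thesis by (simp add: open_cell_in_cell_iff[OF assms])
qed

text \<open>Two representations of \<open>u\<close> agree at some point of each open cell, hence
  have the same coefficient there. This uniqueness gives the definite description in
  \<open>cell_values\<close> its meaning.\<close>

lemma cell_values_eqI:
  assumes "dx > 0" "AE x in lebesgue. u x = grid_fun dx a x"
  shows "cell_values dx u = a"
  unfolding cell_values_def
proof (rule the_equality)
  fix b assume "AE x in lebesgue. u x = grid_fun dx b x"
  with assms(2) have ae: "AE x in lebesgue. grid_fun dx a x = grid_fun dx b x"
    by eventually_elim simp
  show "b = a"
  proof
    fix j
    show "b j = a j"
      using AE_lebesgue_ex_in_open[OF ae, of "open_cell dx j"] open_cell_nonempty[OF assms(1)]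
        grid_fun_open_cell[OF assms(1)] by (auto simp: open_cell_def)
  qed
qed (rule assms(2))

lemma admissible_data_AE_cell_values:
  assumes "dx > 0" "u \<in> admissible_data dx M K"
  shows "AE x in lebesgue. u x = grid_fun dx (cell_values dx u) x"
proof -
  obtain a where "AE x in lebesgue. u x = grid_fun dx a x"
    using assms(2) by (auto simp: admissible_data_def)
  with cell_values_eqI[OF assms(1) this] show ?thesis by simp
qed

lemma admissible_data_cell_values_unit:
  assumes "dx > 0" "u \<in> admissible_data dx M K"
  shows "cell_values dx u j \<in> {0..1}"
proof -
  have "AE x in lebesgue. u x \<in> {0..1}" using assms by (simp add: admissible_data_def)
  with admissible_data_AE_cell_values[OF assms]
  have ae: "AE x in lebesgue. grid_fun dx (cell_values dx u) x \<in> {0..1}"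
    by eventually_elim simp
  show ?thesis
    using AE_lebesgue_ex_in_open[OF ae, of "open_cell dx j"] open_cell_nonempty[OF assms(1)]
      grid_fun_open_cell[OF assms(1)] by (auto simp: open_cell_def)
qed

text \<open>On the interior of cell \<open>j\<close>, of length \<open>dx\<close>, the difference of
  the data is almost everywhere the constant difference of their coefficients; one cell alone
  contributes the left-hand side to the L1 distance. With \<open>dx\<close> fixed, L1 convergence
  therefore forces convergence of every coefficient.\<close>

lemma cell_values_dist_le:
  assumes "dx > 0" "u \<in> admissible_data dx M K" "w \<in> admissible_data dx M K"
  shows "dx * \<bar>cell_values dx w j - cell_values dx u j\<bar> \<le> L1_dist w u"
proof -
  let ?c = "\<bar>cell_values dx w j - cell_values dx u j\<bar>"
  have "dx * ?c = (LINT x|lebesgue. ?c * indicator (open_cell dx j) x)"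
    using assms(1) by (simp add: open_cell_def algebra_simps)
  also have "\<dots> \<le> L1_dist w u"
    unfolding L1_dist_def
  proof (rule integral_mono_AE)
    show "integrable lebesgue (\<lambda>x. ?c * indicator (open_cell dx j) x)"
      by (intro integrable_mult_right) (simp add: open_cell_def flip: lmeasurable_iff_integrable)
    show "integrable lebesgue (\<lambda>x. \<bar>w x - u x\<bar>)"
      using assms by (auto simp: admissible_data_def)
    show "AE x in lebesgue. ?c * indicator (open_cell dx j) x \<le> \<bar>w x - u x\<bar>"
      using admissible_data_AE_cell_values[OF assms(1,2)] admissible_data_AE_cell_values[OF assms(1,3)]
      by eventually_elim (auto simp: indicator_def grid_fun_open_cell[OF assms(1)])
  qed
  finally show ?thesis .
qed

lemma cell_values_tendsto:
  assumes "dx > 0" "u \<in> admissible_data dx M K" "\<And>n. w n \<in> admissible_data dx M K"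
    and "(\<lambda>n. L1_dist (w n) u) \<longlonglongrightarrow> 0"
  shows "(\<lambda>n. cell_values dx (w n) j) \<longlonglongrightarrow> cell_values dx u j"
proof -
  have "(\<lambda>n. L1_dist (w n) u / dx) \<longlonglongrightarrow> 0"
    using assms(4) by (rule tendsto_divide_zero)
  moreover have "norm (cell_values dx (w n) j - cell_values dx u j) \<le> L1_dist (w n) u / dx" for n
    using cell_values_dist_le[OF assms(1,2) assms(3)[of n], of j] assms(1) by (simp add: field_simps)
  ultimately have "(\<lambda>n. cell_values dx (w n) j - cell_values dx u j) \<longlonglongrightarrow> 0"
    by (rule Lim_null_comparison[OF always_eventually[OF allI], rotated])
  then show ?thesis by (rule LIM_zero_cancel)
qed

text \<open>All test integrals of the zero function vanish, and it is zero on the open set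
  \<open>UNIV\<close>. It serves as the datum at which the CFL condition is evaluated.\<close>

lemma zero_admissible_data:
  assumes "M \<ge> 0" shows "(\<lambda>_. 0) \<in> admissible_data dx M K"
proof -
  have "total_variation (\<lambda>_. 0) \<le> 0"
    unfolding total_variation_def by (rule SUP_least) (simp add: zero_ereal_def)
  moreover have "ess_support (\<lambda>_. 0) = {}"
    by (auto simp: ess_support_def)
  moreover have "AE x in lebesgue. 0 = grid_fun dx (\<lambda>_. 0) x"
    by (simp add: grid_fun_def)
  ultimately show ?thesis
    using assms unfolding admissible_data_def
    by (auto intro: order_trans[of _ 0] le_less_trans[of _ 0])
qed

section \<open>The schemes\<close>

text \<open>The velocity difference is at least -1, so the height is at least
  \<open>dx - dt\<close>, and \<open>8 * dt \<le> dx\<close> leaves \<open>7 * dt\<close>.\<close>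

lemma EL_height_ge:
  assumes "0 < dt" "8 * dt \<le> dx" "V j \<le> 1" "0 \<le> V (j + 1)"
  shows "7 * dt \<le> EL_height dx dt V j"
proof -
  have "dt * (V (j + 1) - V j) \<ge> dt * (- 1)"
    using assms by (intro mult_left_mono) auto
  then show ?thesis using assms(2) by (simp add: EL_height_def)
qed

text \<open>The height bound gives a factor of at most 1/7, and each of the sums of densities and of
  velocities is at most 2. Estimating one sum by 2 and keeping the other yields two upper bounds:
  the one in \<open>U\<close> controls the outflow when a step is bounded below by 0, the one in
  \<open>V\<close> the inflow when it is bounded above by 1.\<close>

lemma EL_flux_bounds:
  assumes "0 < dt" "8 * dt \<le> dx" "\<And>j. U j \<in> {0..1}"
  defines "V \<equiv> \<lambda>j. 1 - U j"
  shows "0 \<le> dt * EL_flux dx dt V U j"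
    and "dt * EL_flux dx dt V U j \<le> 2/7 * (U j + U (j - 1))"
    and "dt * EL_flux dx dt V U j \<le> 2/7 * (V j + V (j - 1))"
proof -
  let ?p = "U j + U (j - 1)" and ?q = "V j + V (j - 1)" and ?h = "EL_height dx dt V (j - 1)"
  have h: "7 * dt \<le> ?h"
    using EL_height_ge[OF assms(1,2), of V "j - 1"] assms(3)[of j] assms(3)[of "j - 1"]
    by (simp add: V_def)
  then have r: "0 \<le> dt / ?h" "dt / ?h \<le> 1/7"
    using assms(1) by (auto simp: field_simps)
  have pq: "0 \<le> ?p" "?p \<le> 2" "0 \<le> ?q" "?q \<le> 2"
    using assms(3)[of j] assms(3)[of "j - 1"] by (auto simp: V_def)
  have eq: "dt * EL_flux dx dt V U j = dt / ?h * (?p * ?q)"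
    by (simp add: EL_flux_def)
  show "0 \<le> dt * EL_flux dx dt V U j"
    unfolding eq using r pq by (intro mult_nonneg_nonneg)
  have le: "dt / ?h * (?p * ?q) \<le> 1/7 * (?p * ?q)"
    using r pq by (intro mult_right_mono) auto
  have "?p * ?q \<le> ?p * 2" "?p * ?q \<le> 2 * ?q"
    using pq by (intro mult_left_mono mult_right_mono; simp)+
  with le show "dt * EL_flux dx dt V U j \<le> 2/7 * ?p" "dt * EL_flux dx dt V U j \<le> 2/7 * ?q"
    unfolding eq by linarith+
qed

text \<open>A flux enters with weight 1/4, so it costs at most 1/14 of each of two neighbouring
  densities (or of their complements \<open>1 - U\<close>). The averaging part carries them with
  weights 1/4 and 1/2, which dominate. Hence both the new density and its complement are
  nonnegative.\<close>

lemma EL_step_unit: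
  assumes "0 < dt" "8 * dt \<le> dx" "\<And>j. U j \<in> {0..1}"
  shows "EL_step dx dt (\<lambda>j. 1 - U j) U j \<in> {0..1}"
proof -
  let ?F = "EL_flux dx dt (\<lambda>j. 1 - U j) U"
  have eq: "EL_step dx dt (\<lambda>j. 1 - U j) U j =
      (U (j - 1) + 2 * U j + U (j + 1)) / 4 + (dt * ?F j - dt * ?F (j + 1)) / 4"
    by (simp add: EL_step_def right_diff_distrib diff_divide_distrib)
  show ?thesis
    using EL_flux_bounds[where U = U, OF assms, of j] EL_flux_bounds[where U = U, OF assms, of "j + 1"]
      assms(3)[of j] assms(3)[of "j - 1"] assms(3)[of "j + 1"]
    unfolding eq by (simp add: field_simps)
qed

lemma local_velocity_linear:
  assumes "\<And>r. r \<in> {0..1} \<Longrightarrow> v r = 1 - r" "\<And>j. U j \<in> {0..1}"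
  shows "local_velocity v U = (\<lambda>j. 1 - U j)"
  unfolding local_velocity_def fun_eq_iff using assms(1)[OF assms(2)] by simp

text \<open>Since \<open>v\<close> is prescribed only on [0,1], the induction hypothesis is what
  turns the velocity into \<open>1 - U\<close>; \<open>EL_step_unit\<close> then carries the bounds
  to the next time level.\<close>

lemma EL_scheme_local_unit:
  assumes v: "\<And>r. r \<in> {0..1} \<Longrightarrow> v r = 1 - r"
    and "0 < dt" "8 * dt \<le> dx" "\<And>j. a j \<in> {0..1}"
  shows "EL_scheme dx dt (local_velocity v) a m j \<in> {0..1}"
proof (induction m arbitrary: j)
  case (Suc m)
  let ?U = "EL_scheme dx dt (local_velocity v) a m"
  have "local_velocity v ?U = (\<lambda>j. 1 - ?U j)"
    by (rule local_velocity_linear[OF v Suc.IH])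
  then show ?case using EL_step_unit[OF assms(2,3) Suc.IH] by simp
qed (use assms in simp)

section \<open>Continuity of the local scheme in its initial values\<close>

lemma tendsto_EL_step:
  assumes "\<And>j. (\<lambda>n. V n j) \<longlonglongrightarrow> V' j" "\<And>j. (\<lambda>n. U n j) \<longlonglongrightarrow> U' j"
    and "\<And>j. EL_height dx dt V' j \<noteq> 0"
  shows "(\<lambda>n. EL_step dx dt (V n) (U n) j) \<longlonglongrightarrow> EL_step dx dt V' U' j"
proof -
  have "(\<lambda>n. EL_height dx dt (V n) i) \<longlonglongrightarrow> EL_height dx dt V' i" for i
    unfolding EL_height_def by (intro tendsto_intros assms)
  then have "(\<lambda>n. EL_flux dx dt (V n) (U n) i) \<longlonglongrightarrow> EL_flux dx dt V' U' i" for i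
    unfolding EL_flux_def by (intro tendsto_intros assms)
  then show ?thesis
    unfolding EL_step_def by (intro tendsto_intros assms) auto
qed

text \<open>A step at \<open>j\<close> reads only the cells \<open>j - 1\<close>, \<open>j\<close>
  and \<open>j + 1\<close>, so cellwise convergence passes from one time level to the next without
  uniformity in \<open>j\<close>. The invariant interval [0,1] keeps the heights of the limit scheme
  positive, so no denominator degenerates.\<close>

lemma tendsto_EL_scheme_local:
  assumes v: "\<And>r. r \<in> {0..1} \<Longrightarrow> v r = 1 - r"
    and dt: "0 < dt" "8 * dt \<le> dx"
    and unit: "\<And>n j. a n j \<in> {0..1}" "\<And>j. b j \<in> {0..1}"
    and lim: "\<And>j. (\<lambda>n. a n j) \<longlonglongrightarrow> b j"
  shows "(\<lambda>n. EL_scheme dx dt (local_velocity v) (a n) m j)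
    \<longlonglongrightarrow> EL_scheme dx dt (local_velocity v) b m j"
proof (induction m arbitrary: j)
  case (Suc m)
  let ?U = "EL_scheme dx dt (local_velocity v)"
  have V: "local_velocity v (?U c m) = (\<lambda>j. 1 - ?U c m j)" if "\<And>j. c j \<in> {0..1}" for c
    by (rule local_velocity_linear[OF v EL_scheme_local_unit[OF v dt that]])
  have "EL_height dx dt (\<lambda>j. 1 - ?U b m j) i \<noteq> 0" for i
  proof -
    have "7 * dt \<le> EL_height dx dt (\<lambda>j. 1 - ?U b m j) i"
      using EL_scheme_local_unit[OF v dt unit(2), where m = m] by (intro EL_height_ge dt) auto
    then show ?thesis using dt(1) by linarith
  qed
  then show ?case
    using V unit by (auto intro!: tendsto_EL_step tendsto_diff Suc.IH)
qed (use lim in simp)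

section \<open>Approximate solutions on bounded sets\<close>

text \<open>A bounded range of \<open>x\<close> meets finitely many cells, and times up to
  \<open>T\<close> meet finitely many slabs, negative times none. The index set is chosen before
  \<open>vel\<close> and \<open>u\<close>, so a whole sequence of solutions shares it.\<close>

lemma approx_solution_finite_sum:
  assumes "dx > 0" "dt > 0"
  obtains P where "finite P"
    "\<And>vel u t x. t \<le> T \<Longrightarrow> \<bar>x\<bar> \<le> R \<Longrightarrow> approx_solution dx dt vel u (t, x) =
      (\<Sum>(j, m)\<in>P. EL_scheme dx dt vel (cell_values dx u) m j
        * indicator (cell dx j) x * indicator {real m * dt..<(real m + 1) * dt} t)"
proof
  \<comment> \<open>A cell that meets the range has its centre within \<open>R + dx / 2\<close> of
    the origin; the summand 1 covers this half cell.\<close>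
  define P where "P = {- \<lceil>R / dx + 1\<rceil>..\<lceil>R / dx + 1\<rceil>} \<times> {..nat \<lceil>T / dt\<rceil>}"
  show fin: "finite P" by (simp add: P_def)
  fix vel u t x assume t: "t \<le> T" and x: "\<bar>x\<bar> \<le> R"
  have "approx_solution dx dt vel u (t, x) =
    (\<Sum>\<^sub>\<infinity>(j, m)\<in>P. EL_scheme dx dt vel (cell_values dx u) m j
        * indicator (cell dx j) x * indicator {real m * dt..<(real m + 1) * dt} t)"
    unfolding approx_solution_def prod.case
  proof (rule infsum_cong_neutral)
    fix p assume "p \<in> UNIV - P"
    then obtain j m where p: "p = (j, m)" and jm: "(j, m) \<notin> P" by (cases p) auto
    have "x \<notin> cell dx j \<or> t \<notin> {real m * dt..<(real m + 1) * dt}"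
    proof (rule ccontr)
      assume "\<not> ?thesis"
      then have "(of_int j - 1/2) * dx \<le> R" "- R \<le> (of_int j + 1/2) * dx" "real m * dt \<le> T"
        using x t by (auto simp: cell_def)
      then have "of_int j - 1/2 \<le> R / dx" "- (R / dx) \<le> of_int j + 1/2" "real m \<le> T / dt"
        using assms by (auto simp: field_simps)
      then have "j \<le> \<lceil>R / dx + 1\<rceil>" "- \<lceil>R / dx + 1\<rceil> \<le> j" "m \<le> nat \<lceil>T / dt\<rceil>"
        by linarith+
      with jm show False by (simp add: P_def)
    qed
    then show "(case p of (j, m) \<Rightarrow> EL_scheme dx dt vel (cell_values dx u) m j
        * indicator (cell dx j) x * indicator {real m * dt..<(real m + 1) * dt} t) = 0"
      by (auto simp: p)
  qed auto
  then show "approx_solution dx dt vel u (t, x) =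
      (\<Sum>(j, m)\<in>P. EL_scheme dx dt vel (cell_values dx u) m j
        * indicator (cell dx j) x * indicator {real m * dt..<(real m + 1) * dt} t)"
    using fin by simp
qed

text \<open>At the fixed time \<open>T\<close> the slab indicator is a constant, so it is grouped
  with the coefficient and only the cell remains as the set of the step function.\<close>

lemma approx_solution_slice_finite_sum:
  assumes "dx > 0" "dt > 0" "compact C"
  obtains P where
    "\<And>vel u x. x \<in> C \<Longrightarrow> approx_solution dx dt vel u (T, x) =
      (\<Sum>p\<in>P. EL_scheme dx dt vel (cell_values dx u) (snd p) (fst p)
        * indicator {real (snd p) * dt..<(real (snd p) + 1) * dt} T * indicator (cell dx (fst p)) x)"
proof -
  obtain R where R: "\<And>x. x \<in> C \<Longrightarrow> \<bar>x\<bar> \<le> R"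
    using compact_imp_bounded[OF assms(3)] by (auto simp: bounded_iff)
  obtain P where "finite P" and P: "\<And>vel u t x. t \<le> T \<Longrightarrow> \<bar>x\<bar> \<le> R \<Longrightarrow> approx_solution dx dt vel u (t, x) =
      (\<Sum>(j, m)\<in>P. EL_scheme dx dt vel (cell_values dx u) m j
        * indicator (cell dx j) x * indicator {real m * dt..<(real m + 1) * dt} t)"
    by (rule approx_solution_finite_sum[OF assms(1,2), of T R]) (rule that)
  show thesis
  proof (rule that)
    fix vel u x assume "x \<in> C"
    with P[of T x vel u] R show "approx_solution dx dt vel u (T, x) =
      (\<Sum>p\<in>P. EL_scheme dx dt vel (cell_values dx u) (snd p) (fst p)
        * indicator {real (snd p) * dt..<(real (snd p) + 1) * dt} T * indicator (cell dx (fst p)) x)"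
      by (simp add: case_prod_beta mult_ac)
  qed
qed

text \<open>The index has the space component first, the set has time first. Merging both indicators
  into one set gives the form that the lemmas on step functions expect.\<close>

definition slab_cell :: "real \<Rightarrow> real \<Rightarrow> int \<times> nat \<Rightarrow> (real \<times> real) set" where
  "slab_cell dx dt p = {real (snd p) * dt..<(real (snd p) + 1) * dt} \<times> cell dx (fst p)"

lemma approx_solution_compact_finite_sum:
  assumes "dx > 0" "dt > 0" "compact C" "C \<subseteq> {0..T} \<times> UNIV"
  obtains P where
    "\<And>vel u z. z \<in> C \<Longrightarrow> approx_solution dx dt vel u z =
      (\<Sum>p\<in>P. EL_scheme dx dt vel (cell_values dx u) (snd p) (fst p)
        * indicator (slab_cell dx dt p) z)"
proof -
  have "compact (snd ` C)"
    using assms(3) by (intro compact_continuous_image continuous_intros)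
  then obtain R where "\<And>x. x \<in> snd ` C \<Longrightarrow> \<bar>x\<bar> \<le> R"
    using compact_imp_bounded by (force simp: bounded_iff)
  then have R: "\<bar>snd z\<bar> \<le> R" "fst z \<le> T" if "z \<in> C" for z
    using that assms(4) by auto
  obtain P where "finite P" and P: "\<And>vel u t x. t \<le> T \<Longrightarrow> \<bar>x\<bar> \<le> R \<Longrightarrow> approx_solution dx dt vel u (t, x) =
      (\<Sum>(j, m)\<in>P. EL_scheme dx dt vel (cell_values dx u) m j
        * indicator (cell dx j) x * indicator {real m * dt..<(real m + 1) * dt} t)"
    by (rule approx_solution_finite_sum[OF assms(1,2), of T R]) (rule that)
  have ind: "indicator (slab_cell dx dt p) z = (indicator (cell dx (fst p)) (snd z)
      * indicator {real (snd p) * dt..<(real (snd p) + 1) * dt} (fst z) :: real)" for p z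
    by (cases z) (simp add: slab_cell_def indicator_times)
  have "approx_solution dx dt vel u z =
      (\<Sum>p\<in>P. EL_scheme dx dt vel (cell_values dx u) (snd p) (fst p)
        * indicator (slab_cell dx dt p) z)" if "z \<in> C" for vel u z
    using P[of "fst z" "snd z" vel u] R[OF that]
    by (simp add: case_prod_beta ind mult.assoc)
  then show thesis by (rule that)
qed

section \<open>Local integrability and convergence of the approximate solutions\<close>

lemma lmeasurable_cell: "cell dx j \<in> lmeasurable"
  by (simp add: cell_def)

lemma lmeasurable_slab_cell: "slab_cell dx dt p \<in> lmeasurable"
proof (rule bounded_set_imp_lmeasurable)
  show "bounded (slab_cell dx dt p)"
    unfolding slab_cell_def cell_def by (intro bounded_Times) auto
  have "slab_cell dx dt p \<in> sets borel"
    unfolding slab_cell_def cell_def borel_prod[symmetric] by (intro pair_measureI) auto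
  then show "slab_cell dx dt p \<in> sets lebesgue" by simp
qed

lemma approx_solution_slice_L1loc:
  assumes "dx > 0" "dt > 0"
  shows "(\<lambda>x. approx_solution dx dt vel u (T, x)) \<in> L1loc S"
proof -
  have "(\<lambda>x. approx_solution dx dt vel u (T, x)) absolutely_integrable_on C" if C: "compact C" for C
    by (rule approx_solution_slice_finite_sum[OF assms C, of T])
      (rule finite_step_function_integrable[OF C, where A = "\<lambda>p. cell dx (fst p)"],
        auto simp: lmeasurable_cell)
  then show ?thesis by (simp add: L1loc_def)
qed

lemma approx_solution_L1loc:
  assumes "dx > 0" "dt > 0"
  shows "approx_solution dx dt vel u \<in> L1loc ({0..T} \<times> UNIV)"
proof -
  have "approx_solution dx dt vel u absolutely_integrable_on C"
    if C: "compact C" "C \<subseteq> {0..T} \<times> UNIV" for C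
    by (rule approx_solution_compact_finite_sum[OF assms C])
      (rule finite_step_function_integrable[OF C(1), where A = "slab_cell dx dt"],
        auto simp: lmeasurable_slab_cell)
  then show ?thesis by (simp add: L1loc_def)
qed

lemma approx_solution_slice_tendsto:
  assumes "dx > 0" "dt > 0" "compact C"
    and lim: "\<And>m j. (\<lambda>n. EL_scheme dx dt vel (cell_values dx (w n)) m j)
      \<longlonglongrightarrow> EL_scheme dx dt vel (cell_values dx u) m j"
  shows "(\<lambda>n. LINT x:C|lebesgue.
    \<bar>approx_solution dx dt vel (w n) (T, x) - approx_solution dx dt vel u (T, x)\<bar>) \<longlonglongrightarrow> 0"
proof -
  \<comment> \<open>One index set represents \<open>u\<close> and every \<open>w n\<close>, so only
    the coefficients depend on \<open>n\<close>.\<close>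
  obtain P where P: "\<And>u x. x \<in> C \<Longrightarrow> approx_solution dx dt vel u (T, x) =
      (\<Sum>p\<in>P. EL_scheme dx dt vel (cell_values dx u) (snd p) (fst p)
        * indicator {real (snd p) * dt..<(real (snd p) + 1) * dt} T * indicator (cell dx (fst p)) x)"
    using approx_solution_slice_finite_sum[OF assms(1-3), of T thesis] by blast
  show ?thesis
    by (rule finite_step_function_seminorm_tendsto[OF assms(3) lmeasurable_cell P P])
      (auto intro!: tendsto_intros lim)
qed

lemma approx_solution_tendsto:
  assumes "dx > 0" "dt > 0" "compact C" "C \<subseteq> {0..T} \<times> UNIV"
    and lim: "\<And>m j. (\<lambda>n. EL_scheme dx dt vel (cell_values dx (w n)) m j)
      \<longlonglongrightarrow> EL_scheme dx dt vel (cell_values dx u) m j"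
  shows "(\<lambda>n. LINT z:C|lebesgue.
    \<bar>approx_solution dx dt vel (w n) z - approx_solution dx dt vel u z\<bar>) \<longlonglongrightarrow> 0"
proof -
  obtain P where P: "\<And>u z. z \<in> C \<Longrightarrow> approx_solution dx dt vel u z =
      (\<Sum>p\<in>P. EL_scheme dx dt vel (cell_values dx u) (snd p) (fst p)
        * indicator (slab_cell dx dt p) z)"
    using approx_solution_compact_finite_sum[OF assms(1-4), of thesis] by blast
  show ?thesis
    by (rule finite_step_function_seminorm_tendsto[OF assms(3) lmeasurable_slab_cell P P])
      (auto intro!: lim)
qed

section \<open>Gamma-convergence\<close>

text \<open>The convolution sums run over \<open>k = 0\<close> alone, and the weight
  \<open>\<eta> 0 / H\<close> cancels. It has to be nonzero: otherwise the quotient would be 0 / 0,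
  which is 0 by convention, instead of \<open>U j\<close>.\<close>

lemma nonlocal_velocity_eq_local:
  assumes "0 < H" "H \<le> dx" "\<eta> 0 \<noteq> 0"
  shows "nonlocal_velocity dx v \<eta> H = local_velocity v"
proof -
  have "\<lceil>H / dx\<rceil> = 1"
    using assms(1,2) by (intro ceiling_unique) (auto simp: field_simps)
  then have "discrete_convolution dx \<eta> H U j = U j" for U j
    using assms by (simp add: discrete_convolution_def scaled_kernel_def)
  then show ?thesis
    by (simp add: nonlocal_velocity_def local_velocity_def fun_eq_iff)
qed

text \<open>Along any sequence of parameters tending to 0 the functionals are eventually equal to
  \<open>F0\<close>. The liminf inequality is then sequential lower semicontinuity of
  \<open>F0\<close>, and constant sequences are recovery sequences.\<close>

lemma gamma_converges_eventually_eqI: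
  assumes "\<And>u. u \<in> X \<Longrightarrow> d u u = 0"
    and eq: "\<And>H. 0 < H \<Longrightarrow> H \<le> \<delta> \<Longrightarrow> F H = F0" and "0 < \<delta>"
    and lsc: "\<And>u w a. u \<in> X \<Longrightarrow> (\<And>n. w n \<in> X) \<Longrightarrow> (\<lambda>n. d (w n) u) \<longlonglongrightarrow> 0 \<Longrightarrow> a < F0 u \<Longrightarrow>
      \<forall>\<^sub>F n in sequentially. a < F0 (w n)"
  shows "gamma_converges X d F F0"
  unfolding gamma_converges_def
proof (intro allI impI, elim conjE)
  fix H :: "nat \<Rightarrow> real" assume H: "\<forall>n. H n > 0" "H \<longlonglongrightarrow> 0"
  have ev: "\<forall>\<^sub>F n in sequentially. F (H n) = F0"
    using order_tendstoD(2)[OF H(2) \<open>0 < \<delta>\<close>] by eventually_elim (use H(1) eq in auto)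
  show "(\<forall>u\<in>X. \<forall>w. (\<forall>n. w n \<in> X) \<and> (\<lambda>n. d (w n) u) \<longlonglongrightarrow> 0 \<longrightarrow>
           ereal (F0 u) \<le> liminf (\<lambda>n. ereal (F (H n) (w n)))) \<and>
        (\<forall>u\<in>X. \<exists>w. (\<forall>n. w n \<in> X) \<and> (\<lambda>n. d (w n) u) \<longlonglongrightarrow> 0 \<and>
           (\<lambda>n. F (H n) (w n)) \<longlonglongrightarrow> F0 u)"
  proof (intro conjI ballI allI impI)
    fix u w assume u: "u \<in> X" and w: "(\<forall>n. w n \<in> X) \<and> (\<lambda>n. d (w n) u) \<longlonglongrightarrow> 0"
    show "ereal (F0 u) \<le> liminf (\<lambda>n. ereal (F (H n) (w n)))"
      unfolding le_Liminf_iff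
    proof (intro allI impI)
      fix y assume "y < ereal (F0 u)"
      \<comment> \<open>The level \<open>y\<close> may be minus infinity, whereas \<open>lsc\<close>
        speaks of real levels; a real number in between links the two.\<close>
      then obtain a where a: "y \<le> ereal a" "a < F0 u"
        by (metis ereal_dense2 less_ereal.simps(1) less_imp_le)
      have "\<forall>\<^sub>F n in sequentially. a < F0 (w n)"
        using lsc[OF u _ _ a(2)] w by blast
      with ev show "\<forall>\<^sub>F n in sequentially. y < ereal (F (H n) (w n))"
        by eventually_elim (use a(1) in \<open>auto intro: le_less_trans\<close>)
    qed
  next
    fix u assume u: "u \<in> X"
    have "(\<lambda>n. F (H n) u) \<longlonglongrightarrow> F0 u"
      by (rule tendsto_eventually) (use ev in \<open>auto elim: eventually_mono\<close>)
    then show "\<exists>w. (\<forall>n. w n \<in> X) \<and> (\<lambda>n. d (w n) u) \<longlonglongrightarrow> 0 \<and> (\<lambda>n. F (H n) (w n)) \<longlonglongrightarrow> F0 u"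
      using u assms(1) by (intro exI[of _ "\<lambda>_. u"]) simp
  qed
qed

theorem theorem4p3:
  fixes v \<eta> :: "real \<Rightarrow> real"
    and T M\<^sub>\<Delta> dx dt :: real
    and K :: "real set"
    and \<J> \<I> :: "(real \<Rightarrow> real) \<Rightarrow> real"
    and \<K> :: "(real \<times> real \<Rightarrow> real) \<Rightarrow> real"
  assumes v: "\<And>r. r \<in> {0..1} \<Longrightarrow> v r = 1 - r"
    and \<eta>_C2: "C2_on {-1..0} \<eta>"
    and \<eta>_zero: "\<And>x. x \<notin> {-1..0} \<Longrightarrow> \<eta> x = 0"
    and \<eta>_mono: "mono_on {-1..0} \<eta>"
    and \<eta>_L1: "integrable lebesgue \<eta>" "(LINT x|lebesgue. \<bar>\<eta> x\<bar>) = 1"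
    and \<eta>_left: "\<eta> (-1) = 0"
    and T: "T > 0" and M: "M\<^sub>\<Delta> > 0" and dx: "dx > 0" and dt: "dt > 0"
    and K: "compact (closure K)"
    and CFL_local: "\<And>u m j. u \<in> admissible_data dx M\<^sub>\<Delta> K \<Longrightarrow>
      \<bar>local_velocity v (EL_scheme dx dt (local_velocity v) (cell_values dx u) m) j\<bar>
        \<le> 1/8 * (dx / dt)"
    and CFL_nonlocal: "\<And>H u m j. H > 0 \<Longrightarrow> u \<in> admissible_data dx M\<^sub>\<Delta> K \<Longrightarrow>
      \<bar>nonlocal_velocity dx v \<eta> H
          (EL_scheme dx dt (nonlocal_velocity dx v \<eta> H) (cell_values dx u) m) j\<bar>
        \<le> 1/8 * (dx / dt)"
    and \<J>: "continuous_map (L1loc_topology UNIV) euclideanreal \<J>"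
      "\<And>f. f \<in> L1loc UNIV \<Longrightarrow> \<J> f \<ge> 0"
    and \<K>: "continuous_map (L1loc_topology ({0..T} \<times> UNIV)) euclideanreal \<K>"
      "\<And>f. f \<in> L1loc ({0..T} \<times> UNIV) \<Longrightarrow> \<K> f \<ge> 0"
    and \<I>: "lower_semicontinuous_map (L1loc_topology UNIV) \<I>"
      "\<And>f. f \<in> L1loc UNIV \<Longrightarrow> \<I> f \<ge> 0"
  shows "gamma_converges (admissible_data dx M\<^sub>\<Delta> K) L1_dist
    (\<lambda>H. cost \<J> \<K> \<I> T (approx_solution dx dt (nonlocal_velocity dx v \<eta> H)))
    (cost \<J> \<K> \<I> T (approx_solution dx dt (local_velocity v)))"
proof -
  let ?X = "admissible_data dx M\<^sub>\<Delta> K"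
  let ?U = "approx_solution dx dt (local_velocity v)"
  \<comment> \<open>A nondecreasing kernel with the value 0 at both ends of [-1,0] would vanish
    identically, against its unit L1 norm.\<close>
  have \<eta>0: "\<eta> 0 \<noteq> 0"
  proof
    assume "\<eta> 0 = 0"
    have "\<eta> x = 0" for x
    proof (cases "x \<in> {-1..0}")
      case True
      then have "\<eta> (-1) \<le> \<eta> x" "\<eta> x \<le> \<eta> 0"
        by (auto intro!: mono_onD[OF \<eta>_mono])
      with \<eta>_left \<open>\<eta> 0 = 0\<close> show ?thesis by simp
    qed (rule \<eta>_zero)
    then show False using \<eta>_L1(2) by simp
  qed
  \<comment> \<open>The velocity of the zero datum is 1, which turns the CFL condition into a bound on the mesh ratio.\<close>
  have cfl: "8 * dt \<le> dx"
  proof -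
    have zero: "(\<lambda>_. 0) \<in> ?X" using M by (intro zero_admissible_data) simp
    have "cell_values dx (\<lambda>_. 0) = (\<lambda>_. 0)"
      by (rule cell_values_eqI[OF dx]) (simp add: grid_fun_def)
    then have "1 \<le> 1/8 * (dx / dt)"
      using CFL_local[OF zero, of 0 0] v[of 0] by (simp add: local_velocity_def)
    then show ?thesis using dt by (simp add: field_simps)
  qed
  show ?thesis
  proof (rule gamma_converges_eventually_eqI[of _ _ dx])
    show "L1_dist u u = 0" for u by (simp add: L1_dist_def)
    show "cost \<J> \<K> \<I> T (approx_solution dx dt (nonlocal_velocity dx v \<eta> H))
        = cost \<J> \<K> \<I> T ?U" if "0 < H" "H \<le> dx" for H
      using nonlocal_velocity_eq_local[of H dx \<eta> v] that \<eta>0 by simp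
    fix u w a assume u: "u \<in> ?X" and w: "\<And>n. w n \<in> ?X"
      and lim: "(\<lambda>n. L1_dist (w n) u) \<longlonglongrightarrow> 0" and a: "a < cost \<J> \<K> \<I> T ?U u"
    have scheme: "(\<lambda>n. EL_scheme dx dt (local_velocity v) (cell_values dx (w n)) m j)
        \<longlonglongrightarrow> EL_scheme dx dt (local_velocity v) (cell_values dx u) m j" for m j
      by (rule tendsto_EL_scheme_local[OF v dt cfl])
        (use cell_values_tendsto[OF dx u w lim] admissible_data_cell_values_unit[OF dx u]
          admissible_data_cell_values_unit[OF dx w] in auto)
    have J: "(\<lambda>n. \<J> (\<lambda>x. ?U (w n) (T, x))) \<longlonglongrightarrow> \<J> (\<lambda>x. ?U u (T, x))"
      by (rule L1loc_continuous_map_tendsto[OF \<J>(1)])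
        (auto intro!: approx_solution_slice_L1loc approx_solution_slice_tendsto dx dt scheme)
    have K: "(\<lambda>n. \<K> (?U (w n))) \<longlonglongrightarrow> \<K> (?U u)"
      by (rule L1loc_continuous_map_tendsto[OF \<K>(1)])
        (auto intro!: approx_solution_L1loc approx_solution_tendsto[of _ _ _ T] dx dt scheme)
    \<comment> \<open>Half of the gap above \<open>a\<close> is allotted to the loss in
      \<open>\<I>\<close>, the other half to the loss in the sum of \<open>\<J>\<close> and
      \<open>\<K>\<close>.\<close>
    define e where "e = (cost \<J> \<K> \<I> T ?U u - a) / 2"
    have e: "e > 0" using a by (simp add: e_def)
    have int: "integrable lebesgue u" "integrable lebesgue (w n)" for n
      using u w[of n] by (auto simp: admissible_data_def)
    have I: "\<forall>\<^sub>F n in sequentially. \<I> u - e < \<I> (w n)"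
    proof (rule L1loc_lower_semicontinuous_eventually[OF \<I>(1)])
      fix C :: "real set" assume C: "compact C"
      show "(\<lambda>n. LINT x:C|lebesgue. \<bar>w n x - u x\<bar>) \<longlonglongrightarrow> 0"
      \<comment> \<open>Every seminorm of \<open>w n - u\<close> on a compact set lies between 0 and
        the L1 distance, so L1 convergence of the data implies local L1 convergence.\<close>
      proof (rule tendsto_sandwich[OF _ _ tendsto_const lim])
        show "\<forall>\<^sub>F n in sequentially. 0 \<le> (LINT x:C|lebesgue. \<bar>w n x - u x\<bar>)"
          by (auto simp: set_lebesgue_integral_def intro!: always_eventually integral_nonneg)
        show "\<forall>\<^sub>F n in sequentially. (LINT x:C|lebesgue. \<bar>w n x - u x\<bar>) \<le> L1_dist (w n) u"
          using L1_dist_bounds_seminorm[OF int(2,1) C] by simp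
      qed
    qed (use int e in \<open>auto intro: integrable_imp_L1loc\<close>)
    have "\<forall>\<^sub>F n in sequentially. \<J> (\<lambda>x. ?U u (T, x)) + \<K> (?U u) - e
        < \<J> (\<lambda>x. ?U (w n) (T, x)) + \<K> (?U (w n))"
      by (rule order_tendstoD(1)[OF tendsto_add[OF J K]]) (use e in simp)
    with I show "\<forall>\<^sub>F n in sequentially. a < cost \<J> \<K> \<I> T ?U (w n)"
      by eventually_elim (simp add: cost_def e_def field_simps)
  qed (rule dx)
qed

end
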